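(* Let $k\geq 2$ and let $\varphi\colon\mathcal{A}\to\mathcal{A}^*$ be a (growing) substitution of constant length $k$. Let $X_\varphi\subset\mathcal{A}^{\mathbf{N}}$ be the one-sided system generated by $\varphi$, let $Y\subset\mathcal{B}^{\mathbf{N}}$ be a one-sided subshift and let $\pi\colon X_\varphi\to Y$ be a factor map. Then: (1) A sequence $y\in Y$ is $k$-automatic if and only if $y=\pi(x)$ for some quasi-fixed point $x$ of $\varphi$. (2) If $y\in Y$ is $k$-automatic and nonperiodic, then all points in $\pi^{-1}(y)$ are quasi-fixed points of $\varphi$.
   Context: Everything here is one-sided. $\mathbf{N}=\{0,1,2,\ldots\}$. A substitution $\varphi\colon\mathcal{A}\to\mathcal{A}^*$ is growing ($|\varphi^n(a)|\to\infty$ for all $a$) and has constant length $k$ if $|\varphi(a)|=k$ for all $a$; it acts on $\mathcal{A}^{\mathbf{N}}$ by concatenation. $T$ is the one-sided shift $(Tx)_n=x_{n+1}$. $X_\varphi=\{x\in\mathcal{A}^{\mathbf{N}}:$ every finite factor of $x$ appears in $\varphi^n(a)$ for some $a\in\mathcal{A}$, $n\geq0\}$. A one-sided subshift is a closed subset $Y\subset\mathcal{B}^{\mathbf{N}}$ with $T(Y)\subset Y$; a factor map is a continuous surjection commuting with the shifts. A point $y$ is periodic if $T^py=y$ for some $p\geq1$. Convention: for $c<0$, "$T^c(x)=y$" means $x=T^{-c}(y)$. A point $z\in\mathcal{A}^{\mathbf{N}}$ is a quasi-fixed point of $\varphi$ if $T^c(\varphi^m(z))=z$ for some $m\geq1$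 and $c\in\mathbf{Z}$. A one-sided sequence is $k$-automatic if it is the image under a coding of a fixed point of a substitution of constant length $k$. *)

theory Defs
  imports Main "HOL-Library.Sublist"
begin

definition shift :: "(nat \<Rightarrow> 'a) \<Rightarrow> nat \<Rightarrow> 'a" where
  "shift x = (\<lambda>n. x (Suc n))"

definition shiftn :: "nat \<Rightarrow> (nat \<Rightarrow> 'a) \<Rightarrow> nat \<Rightarrow> 'a" where
  "shiftn p x = (\<lambda>n. x (n + p))"

definition const_length :: "nat \<Rightarrow> ('a \<Rightarrow> 'a list) \<Rightarrow> bool" where
  "const_length k \<phi> \<longleftrightarrow> (\<forall>a. length (\<phi> a) = k)"

text \<open>Action of a substitution of constant length k on a one-sided sequence
  (concatenation of the blocks phi(x_0) phi(x_1) ...).\<close>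
definition subst_seq :: "nat \<Rightarrow> ('a \<Rightarrow> 'a list) \<Rightarrow> (nat \<Rightarrow> 'a) \<Rightarrow> nat \<Rightarrow> 'a" where
  "subst_seq k \<phi> x = (\<lambda>n. \<phi> (x (n div k)) ! (n mod k))"

primrec subst_word_pow :: "('a \<Rightarrow> 'a list) \<Rightarrow> nat \<Rightarrow> 'a \<Rightarrow> 'a list" where
  "subst_word_pow \<phi> 0 a = [a]"
| "subst_word_pow \<phi> (Suc n) a = concat (map \<phi> (subst_word_pow \<phi> n a))"

definition factor_of :: "(nat \<Rightarrow> 'a) \<Rightarrow> nat \<Rightarrow> nat \<Rightarrow> 'a list" where
  "factor_of x i j = map x [i..<j]"

definition subst_system :: "('a \<Rightarrow> 'a list) \<Rightarrow> (nat \<Rightarrow> 'a) set" where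
  "subst_system \<phi> = {x. \<forall>i j. \<exists>a n. sublist (factor_of x i j) (subst_word_pow \<phi> n a)}"

text \<open>Agreement on the first n coordinates; continuity for the product of discrete topologies.\<close>
definition agree :: "nat \<Rightarrow> (nat \<Rightarrow> 'a) \<Rightarrow> (nat \<Rightarrow> 'a) \<Rightarrow> bool" where
  "agree n x x' \<longleftrightarrow> (\<forall>i<n. x i = x' i)"

definition seq_continuous_on :: "(nat \<Rightarrow> 'a) set \<Rightarrow> ((nat \<Rightarrow> 'a) \<Rightarrow> (nat \<Rightarrow> 'b)) \<Rightarrow> bool" where
  "seq_continuous_on X f \<longleftrightarrow>
     (\<forall>x\<in>X. \<forall>n. \<exists>m. \<forall>x'\<in>X. agree m x x' \<longrightarrow> agree n (f x) (f x'))"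

definition seq_closed :: "(nat \<Rightarrow> 'a) set \<Rightarrow> bool" where
  "seq_closed Y \<longleftrightarrow> (\<forall>y. (\<forall>n. \<exists>y'\<in>Y. agree n y y') \<longrightarrow> y \<in> Y)"

definition subshift :: "(nat \<Rightarrow> 'b) set \<Rightarrow> bool" where
  "subshift Y \<longleftrightarrow> seq_closed Y \<and> shift ` Y \<subseteq> Y"

definition factor_map ::
  "(nat \<Rightarrow> 'a) set \<Rightarrow> (nat \<Rightarrow> 'b) set \<Rightarrow> ((nat \<Rightarrow> 'a) \<Rightarrow> (nat \<Rightarrow> 'b)) \<Rightarrow> bool" where
  "factor_map X Y \<pi> \<longleftrightarrow> seq_continuous_on X \<pi> \<and> \<pi> ` X = Y \<and>
     (\<forall>x\<in>X. \<pi> (shift x) = shift (\<pi> x))"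

definition periodic_seq :: "(nat \<Rightarrow> 'a) \<Rightarrow> bool" where
  "periodic_seq y \<longleftrightarrow> (\<exists>p\<ge>1. shiftn p y = y)"

text \<open>Quasi-fixed point: T^c(phi^m z) = z for some m >= 1, c in Z
  (for c < 0 this means phi^m z = T^{-c} z).\<close>
definition quasi_fixed :: "nat \<Rightarrow> ('a \<Rightarrow> 'a list) \<Rightarrow> (nat \<Rightarrow> 'a) \<Rightarrow> bool" where
  "quasi_fixed k \<phi> z \<longleftrightarrow> (\<exists>m\<ge>1. \<exists>c::int.
      (if c \<ge> 0 then shiftn (nat c) ((subst_seq k \<phi> ^^ m) z) = z
       else (subst_seq k \<phi> ^^ m) z = shiftn (nat (- c)) z))"

text \<open>k-automatic: coding of a fixed point of a constant-length-k substitution on some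
  finite alphabet; finite alphabets are represented as finite subsets of nat.\<close>
definition automatic :: "nat \<Rightarrow> (nat \<Rightarrow> 'b) \<Rightarrow> bool" where
  "automatic k y \<longleftrightarrow> (\<exists>(C::nat set) (\<psi>::nat \<Rightarrow> nat list) (z::nat \<Rightarrow> nat) (\<tau>::nat \<Rightarrow> 'b).
      finite C \<and> (\<forall>c\<in>C. length (\<psi> c) = k \<and> set (\<psi> c) \<subseteq> C) \<and> range z \<subseteq> C \<and>
      subst_seq k \<psi> z = z \<and> y = \<tau> \<circ> z)"

end

theory Submission
  imports Defs "HOL-Library.FuncSet" "HOL-Library.Infinite_Set"
begin

text \<open>
  A factor map is a sliding block code, and every \<open>x \<in> X\<^sub>\<phi>\<close> can be written as \<open>T\<^sup>d \<phi>\<^sup>n w\<close> with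
  \<open>w \<in> X\<^sub>\<phi>\<close> and \<open>0 \<le> d < k\<^sup>n\<close>; it is quasi-fixed as soon as the same \<open>w\<close> serves for two values
  of \<open>n\<close>. If \<open>y\<close> is automatic and not periodic, its prefixes have no periods that are short compared
  with their length, so a prefix of length comparable to \<open>k\<^sup>n\<close> occurs boundedly often in the image of
  \<open>\<phi>\<^sup>n(ab)\<close>. Hence only finitely many \<open>w\<close> satisfy \<open>\<pi> (T\<^sup>d \<phi>\<^sup>n w) = y\<close>, for fixed \<open>n\<close> and \<open>d\<close>. Since the blocks
  of length \<open>k\<^sup>n\<close> of \<open>y\<close> are coded by a sequence independent of \<open>n\<close>, this condition on \<open>w\<close> takes only
  finitely many forms as \<open>n\<close> and \<open>d\<close> vary, and a repetition of \<open>w\<close> follows. Over a periodic \<open>y\<close> a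
  quasi-fixed point is obtained as a limit of points \<open>\<phi>\<^sup>n v\<^sub>n\<close> starting with suitable letters.
  Conversely, images of quasi-fixed points are automatic by the finite kernel criterion.
\<close>

subsection \<open>Compactness of sequence spaces over a finite alphabet\<close>

lemma finite_range_initial_segment:
  fixes f :: "nat \<Rightarrow> 'c"
  assumes "finite (range f)"
  obtains L where "\<And>i. \<exists>i'<L. f i' = f i"
proof -
  define g where "g = inv_into UNIV f"
  have fin: "finite (g ` range f)" using assms by simp
  then obtain L where L: "\<And>m. m \<in> g ` range f \<Longrightarrow> m < L"
    using finite_nat_set_iff_bounded by metis
  have "g (f i) < L \<and> f (g (f i)) = f i" for i
    using L[of "g (f i)"] by (simp add: g_def f_inv_into_f)
  then show thesis using that by blast
qed

lemma infinite_fibre: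
  fixes f :: "nat \<Rightarrow> 'c"
  assumes "finite (f ` I)" "infinite I"
  obtains c where "infinite {n\<in>I. f n = c}"
  using pigeonhole_infinite[OF assms(2,1)] by auto

text \<open>Koenig's argument: a prefix shared by infinitely many \<open>u N\<close> is extended by
  one letter at a time, the pigeonhole principle keeping infinitely many \<open>N\<close> at every
  stage.\<close>

lemma sequence_cluster_point:
  fixes u :: "nat \<Rightarrow> nat \<Rightarrow> 'a::finite"
  obtains v where "\<And>n m. \<exists>N\<ge>m. agree n v (u N)"
proof -
  define P where "P n l \<longleftrightarrow> length l = n \<and> infinite {N. map (u N) [0..<n] = l}" for n l
  have "\<exists>s. \<forall>n. P n (s n) \<and> (\<exists>a. s (Suc n) = s n @ [a])"
  proof (rule dependent_nat_choice)
    show "\<exists>l. P 0 l" by (simp add: P_def)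
  next
    fix l n assume "P n l"
    then have len: "length l = n" and inf: "infinite {N. map (u N) [0..<n] = l}"
      by (auto simp: P_def)
    obtain a where a: "infinite {N \<in> {N. map (u N) [0..<n] = l}. u N n = a}"
      using infinite_fibre[OF _ inf, of "\<lambda>N. u N n"] by auto
    have "P (Suc n) (l @ [a])"
      using len a by (simp add: P_def)
    then show "\<exists>l'. P (Suc n) l' \<and> (\<exists>a. l' = l @ [a])" by blast
  qed
  then obtain s where s: "\<And>n. P n (s n)" "\<And>n. \<exists>a. s (Suc n) = s n @ [a]" by blast
  define v where "v i = s (Suc i) ! i" for i
  have len: "length (s n) = n" for n using s(1)[of n] by (simp add: P_def)
  have sv: "s n ! i = v i" if "i < n" for n i
    using that
  proof (induction n)
    case (Suc n)
    obtain a where a: "s (Suc n) = s n @ [a]" using s(2) by blast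
    show ?case
    proof (cases "i = n")
      case False
      then have "i < n" using Suc.prems by simp
      then show ?thesis using Suc.IH a len by (simp add: nth_append)
    qed (simp add: v_def)
  qed simp
  have "\<exists>N\<ge>m. agree n v (u N)" for n m
  proof -
    have "infinite {N. map (u N) [0..<n] = s n}" using s(1)[of n] by (simp add: P_def)
    then obtain N where N: "N \<ge> m" "map (u N) [0..<n] = s n"
      by (metis (mono_tags, lifting) infinite_nat_iff_unbounded_le mem_Collect_eq)
    have "u N i = v i" if "i < n" for i
    proof -
      have "map (u N) [0..<n] ! i = s n ! i" using N by simp
      then show ?thesis using that sv by simp
    qed
    then show ?thesis using N(1) by (auto simp: agree_def)
  qed
  then show thesis using that by blast
qed

subsection \<open>Powers of a substitution of constant length\<close>

lemma shiftn_apply [simp]: "shiftn p x n = x (n + p)"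
  by (simp add: shiftn_def)

lemma shiftn_shiftn: "shiftn p (shiftn q x) = shiftn (p + q) x"
  by (auto simp: fun_eq_iff algebra_simps)

lemma subst_seq_apply: "subst_seq k \<phi> x i = \<phi> (x (i div k)) ! (i mod k)"
  by (simp add: subst_seq_def)

text \<open>Each step of the induction peels off the lowest base \<open>k\<close> digit of
  \<open>i\<close>. This makes all powers local: letter \<open>i\<close> of the image sees a single
  letter of \<open>x\<close>.\<close>

lemma subst_pow_apply:
  assumes "k > 0"
  shows "(subst_seq k \<phi> ^^ n) x i = (subst_seq k \<phi> ^^ n) (\<lambda>_. x (i div k ^ n)) (i mod k ^ n)"
proof (induction n arbitrary: i)
  case (Suc n)
  have "(i mod (k * k ^ n)) div k = (i div k) mod k ^ n" "(i mod (k * k ^ n)) mod k = i mod k"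
    using assms by (simp_all add: mod_mult2_eq)
  moreover have "i div (k * k ^ n) = i div k div k ^ n"
    by (simp add: div_mult2_eq)
  ultimately show ?case
    using Suc.IH[of "i div k"] by (simp add: subst_seq_apply)
qed simp

lemma subst_pow_cong:
  assumes "k > 0" "x a = x' a'" "b < k ^ n"
  shows "(subst_seq k \<phi> ^^ n) x (k ^ n * a + b) = (subst_seq k \<phi> ^^ n) x' (k ^ n * a' + b)"
  using assms subst_pow_apply[of k n \<phi> x "k ^ n * a + b"]
    subst_pow_apply[of k n \<phi> x' "k ^ n * a' + b"]
  by simp

lemma subst_pow_shiftn:
  assumes "k > 0"
  shows "(subst_seq k \<phi> ^^ n) (shiftn a x) = shiftn (k ^ n * a) ((subst_seq k \<phi> ^^ n) x)"
proof
  fix i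
  have "(i + k ^ n * a) div k ^ n = i div k ^ n + a" using assms by simp
  then show "(subst_seq k \<phi> ^^ n) (shiftn a x) i = shiftn (k ^ n * a) ((subst_seq k \<phi> ^^ n) x) i"
    using subst_pow_apply[OF assms, of n \<phi> "shiftn a x" i]
      subst_pow_apply[OF assms, of n \<phi> x "i + k ^ n * a"] by simp
qed

lemma subst_pow_window:
  assumes "k > 0" "\<And>t. t < s \<Longrightarrow> x (a + t) = x' (a' + t)" "b < s * k ^ n"
  shows "(subst_seq k \<phi> ^^ n) x (k ^ n * a + b) = (subst_seq k \<phi> ^^ n) x' (k ^ n * a' + b)"
proof -
  define t c where "t = b div k ^ n" and "c = b mod k ^ n"
  have b: "b = k ^ n * t + c" by (simp add: t_def c_def)
  have "t < s" using assms(3) by (simp add: t_def less_mult_imp_div_less)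
  then have "x (a + t) = x' (a' + t)" by (rule assms(2))
  moreover have "c < k ^ n" using assms(1) by (simp add: c_def)
  ultimately show ?thesis
    using subst_pow_cong[OF assms(1), of x "a + t" x' "a' + t" c n \<phi>]
    by (simp add: b algebra_simps)
qed

lemma subst_pow_prefix:
  assumes "k > 0" "\<And>t. t < s \<Longrightarrow> x t = x' t" "i < s * k ^ n"
  shows "(subst_seq k \<phi> ^^ n) x i = (subst_seq k \<phi> ^^ n) x' i"
  using subst_pow_window[of k s x 0 x' 0 i n \<phi>] assms by simp

text \<open>When \<open>x\<close> and its image are tails of one sequence \<open>w\<close>, the
  later tail is a shift of the earlier one; the sign of \<open>c\<close> records which is
  later.\<close>

lemma quasi_fixedI:
  assumes "x = shiftn a w" "(subst_seq k \<phi> ^^ m) x = shiftn b w" "m \<ge> 1"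
  shows "quasi_fixed k \<phi> x"
proof (cases "a \<ge> b")
  case True
  have "shiftn (nat (int (a - b))) ((subst_seq k \<phi> ^^ m) x) = x"
    unfolding assms(2) nat_int shiftn_shiftn using True assms(1) by simp
  then show ?thesis unfolding quasi_fixed_def using assms(3)
    by (intro exI[of _ m] conjI exI[of _ "int (a - b)"]) auto
next
  case False
  then have "(subst_seq k \<phi> ^^ m) x = shiftn (nat (- (- int (b - a)))) x"
    unfolding assms(2) minus_minus nat_int by (subst assms(1)) (simp only: shiftn_shiftn, simp)
  then show ?thesis unfolding quasi_fixed_def using assms(3) False
    by (intro exI[of _ m] conjI exI[of _ "- int (b - a)"]) auto
qed

lemma quasi_fixedE:
  assumes "quasi_fixed k \<phi> x"
  obtains m a b where "m \<ge> 1" "shiftn a ((subst_seq k \<phi> ^^ m) x) = shiftn b x"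
proof -
  obtain m c where m: "m \<ge> 1" and c: "if c \<ge> 0 then shiftn (nat c) ((subst_seq k \<phi> ^^ m) x) = x
       else (subst_seq k \<phi> ^^ m) x = shiftn (nat (- c)) x"
    using assms by (auto simp: quasi_fixed_def)
  have "shiftn 0 u = u" for u :: "nat \<Rightarrow> 'a" by (simp add: fun_eq_iff)
  then show thesis
    using c that[OF m, of "nat c" 0] that[OF m, of 0 "nat (- c)"] by (auto split: if_splits)
qed

lemma length_concat_map_const:
  assumes "\<And>a. length (\<phi> a) = k"
  shows "length (concat (map \<phi> w)) = k * length w"
  using assms by (induction w) auto

lemma nth_concat_map_const:
  assumes "\<And>a. length (\<phi> a) = k" "i < k * length w"
  shows "concat (map \<phi> w) ! i = \<phi> (w ! (i div k)) ! (i mod k)"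
  using assms(2)
proof (induction w arbitrary: i)
  case (Cons b w)
  show ?case
  proof (cases "i < k")
    case False
    then obtain j where j: "i = k + j" using le_Suc_ex not_less by blast
    have "k > 0" using Cons.prems by (cases k) auto
    then have "(k + j) div k = Suc (j div k)" by (simp add: div_add_self1)
    then show ?thesis using j Cons assms(1) by (simp add: nth_append)
  qed (simp add: nth_append assms(1))
qed simp

lemma subst_word_pow_nth:
  assumes "const_length k \<phi>" "k > 0"
  shows "length (subst_word_pow \<phi> n a) = k ^ n \<and>
    (\<forall>i<k ^ n. subst_word_pow \<phi> n a ! i = (subst_seq k \<phi> ^^ n) (\<lambda>_. a) i)"
proof (induction n)
  case (Suc n)
  have l: "\<And>a. length (\<phi> a) = k" using assms(1) by (simp add: const_length_def)
  have "subst_word_pow \<phi> (Suc n) a ! i = (subst_seq k \<phi> ^^ Suc n) (\<lambda>_. a) i" if "i < k ^ Suc n" for i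
  proof -
    have "i div k < k ^ n" using that assms(2) by (simp add: less_mult_imp_div_less mult.commute)
    then show ?thesis using that Suc nth_concat_map_const[of \<phi> k i "subst_word_pow \<phi> n a"] l
      by (simp add: subst_seq_apply[of k \<phi> "(subst_seq k \<phi> ^^ n) (\<lambda>_. a)" i])
  qed
  then show ?case using Suc l by (simp add: length_concat_map_const)
qed simp

subsection \<open>Automatic sequences\<close>

text \<open>The kernel criterion. The letter at \<open>n\<close> is the vector of all values
  \<open>f n\<close> with \<open>f\<close> in \<open>S\<close>. Closure under decimation means that
  the vector at \<open>n\<close> determines those at \<open>k * n + j\<close>, which defines the
  substitution; evaluation at \<open>y\<close> is the coding.\<close>

lemma automatic_if_decimation_closed:
  fixes y :: "nat \<Rightarrow> 'b::finite"
  assumes "finite S" "y \<in> S" and closed: "\<And>f j. f \<in> S \<Longrightarrow> j < k \<Longrightarrow> (\<lambda>i. f (k * i + j)) \<in> S"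
    and "k > 0"
  shows "automatic k y"
proof -
  define z' where "z' n = restrict (\<lambda>f. f n) S" for n
  have "range z' \<subseteq> S \<rightarrow>\<^sub>E UNIV" by (auto simp: z'_def)
  then have fin: "finite (range z')"
    using finite_PiE[OF assms(1), of "\<lambda>_. UNIV :: 'b set"] finite_subset by auto
  \<comment> \<open>\<open>automatic\<close> asks for an alphabet inside \<open>nat\<close>, so the
    vectors are numbered by \<open>h\<close> and decoded by \<open>g\<close>.\<close>
  obtain h :: "_ \<Rightarrow> nat" where h: "inj_on h (range z')"
    using finite_imp_inj_to_nat_seg[OF fin] by blast
  define g where "g = inv_into (range z') h"
  have g: "g (h (z' n)) = z' n" for n using h by (simp add: g_def)
  define \<psi> where "\<psi> c = map (\<lambda>j. h (restrict (\<lambda>f. g c (\<lambda>i. f (k * i + j))) S)) [0..<k]" for c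
  have step: "\<psi> (h (z' n)) ! j = h (z' (k * n + j))" if "j < k" for n j
  proof -
    have "restrict (\<lambda>f. z' n (\<lambda>i. f (k * i + j))) S = z' (k * n + j)"
      using that closed by (auto simp: z'_def restrict_def fun_eq_iff)
    then show ?thesis using that by (simp add: \<psi>_def g)
  qed
  have len: "length (\<psi> c) = k" for c by (simp add: \<psi>_def)
  have "set (\<psi> (h (z' n))) \<subseteq> h ` range z'" for n
    using step len by (fastforce simp: in_set_conv_nth)
  moreover have "subst_seq k \<psi> (h \<circ> z') = h \<circ> z'"
    using step \<open>k > 0\<close> by (auto simp: subst_seq_def fun_eq_iff)
  moreover have "y = (\<lambda>c. g c y) \<circ> (h \<circ> z')"
    using g \<open>y \<in> S\<close> by (auto simp: z'_def fun_eq_iff)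
  ultimately show ?thesis
    unfolding automatic_def using fin len
    by (intro exI[of _ "h ` range z'"] exI[of _ \<psi>] exI[of _ "h \<circ> z'"] exI[of _ "\<lambda>c. g c y"]) auto
qed

text \<open>A decimation by \<open>k ^ m\<close> is split into \<open>m\<close> decimations by
  \<open>k\<close>: adjoining the intermediate stages \<open>r < m\<close> gives a finite family
  closed under single ones.\<close>

lemma automatic_if_power_decimation_closed:
  fixes y :: "nat \<Rightarrow> 'b::finite"
  assumes "finite S" "y \<in> S" "k > 0" "m \<ge> 1"
    and closed: "\<And>f j. f \<in> S \<Longrightarrow> j < k ^ m \<Longrightarrow> (\<lambda>i. f (k ^ m * i + j)) \<in> S"
  shows "automatic k y"
proof -
  define D where "D = (SIGMA r:{..<m}. {..<k ^ r})"
  define S' where "S' = (\<lambda>(f, r, j). \<lambda>i. f (k ^ r * i + j)) ` (S \<times> D)"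
  have S'I: "(\<lambda>i. f (k ^ r * i + j)) \<in> S'" if "f \<in> S" "r < m" "j < k ^ r" for f r j
    using that by (force simp: S'_def D_def)
  show ?thesis
  proof (rule automatic_if_decimation_closed[of S'])
    show "finite S'" using assms(1) by (auto simp: S'_def D_def)
    show "y \<in> S'" using S'I[OF \<open>y \<in> S\<close>, of 0 0] \<open>m \<ge> 1\<close> by simp
    show "(\<lambda>i. g (k * i + t)) \<in> S'" if g: "g \<in> S'" and t: "t < k" for g t
    proof -
      obtain f r j where frj: "f \<in> S" "r < m" "j < k ^ r" "g = (\<lambda>i. f (k ^ r * i + j))"
        using g by (auto simp: S'_def D_def)
      define j' where "j' = k ^ r * t + j"
      have "k ^ r * (t + 1) \<le> k ^ r * k" using t by (intro mult_le_mono) auto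
      then have j': "j' < k ^ Suc r" using frj(3) by (simp add: j'_def algebra_simps)
      have eq: "(\<lambda>i. g (k * i + t)) = (\<lambda>i. f (k ^ Suc r * i + j'))"
        by (simp add: frj(4) j'_def algebra_simps)
      show ?thesis
      proof (cases "Suc r < m")
        case True
        then show ?thesis using S'I[OF frj(1) True j'] eq by simp
      next
        case False
        then have "Suc r = m" using frj(2) by simp
        then have "(\<lambda>i. g (k * i + t)) \<in> S" using closed[OF frj(1)] j' eq by metis
        then show ?thesis using S'I[of _ 0 0] \<open>m \<ge> 1\<close> by simp
      qed
    qed
  qed fact
qed

lemma automatic_blocks:
  assumes "automatic k y" "k > 0"
  obtains z :: "nat \<Rightarrow> nat" and G where "finite (range z)"
    "\<And>n a b. b < k ^ n \<Longrightarrow> y (k ^ n * a + b) = G n b (z a)"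
proof -
  obtain C \<psi> z \<tau> where C: "finite (C::nat set)" "range z \<subseteq> C" "subst_seq k \<psi> z = z" "y = \<tau> \<circ> z"
    using assms(1) by (auto simp: automatic_def)
  have pow: "(subst_seq k \<psi> ^^ n) z = z" for n
    by (induction n) (use C(3) in auto)
  show thesis
  proof
    show "finite (range z)" using C finite_subset by blast
    show "y (k ^ n * a + b) = \<tau> ((subst_seq k \<psi> ^^ n) (\<lambda>_. z a) b)" if "b < k ^ n" for n a b
      using subst_pow_cong[OF assms(2), of z a "\<lambda>_. z a" 0 b n \<psi>] that pow C(4) by simp
  qed
qed

text \<open>A prefix of \<open>y\<close> covering all triples of states at distance comparable to \<open>p\<close> already
  sees whether \<open>p\<close> is a period of \<open>y\<close>.\<close>

lemma automatic_nonperiodic_prefix: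
  assumes aut: "automatic k y" and k: "k \<ge> 2" and np: "\<not> periodic_seq y"
  obtains C where "C > 0" "\<And>p. p \<ge> 1 \<Longrightarrow> \<exists>i<C * p. y i \<noteq> y (i + p)"
proof -
  have k0: "k > 0" using k by simp
  obtain z :: "nat \<Rightarrow> nat" and G where fin: "finite (range z)"
    and G: "\<And>n a b. b < k ^ n \<Longrightarrow> y (k ^ n * a + b) = G n b (z a)"
    using automatic_blocks[OF aut k0] by metis
  \<comment> \<open>With \<open>k ^ n \<le> p < k ^ (n + 1)\<close>, adding \<open>p\<close> moves a
    position ahead by \<open>u \<le> k\<close> blocks of length \<open>k ^ n\<close>, so windows of
    \<open>k + 1\<close> states see both ends.\<close>
  define f where "f i = map (\<lambda>q. z (i + q)) [0..<Suc k]" for i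
  have "range f \<subseteq> {l. set l \<subseteq> range z \<and> length l = Suc k}" by (auto simp: f_def)
  then have "finite (range f)" using finite_lists_length_eq[OF fin] finite_subset by blast
  then obtain L where L: "\<And>i. \<exists>i'<L. f i' = f i" using finite_range_initial_segment by blast
  have f_eq: "z (i + q) = z (i' + q)" if "f i = f i'" "q \<le> k" for i i' q
  proof -
    have "f i ! q = f i' ! q" using that by simp
    then show ?thesis using that(2) by (simp add: f_def del: upt_Suc)
  qed
  have "\<exists>i<L * p. y i \<noteq> y (i + p)" if p: "p \<ge> 1" for p
  proof (rule ccontr)
    assume "\<not> ?thesis"
    then have per: "\<And>i. i < L * p \<Longrightarrow> y i = y (i + p)" by blast
    obtain n where n: "k ^ n \<le> p" "p < k ^ (n + 1)"
      using ex_power_ivl1[OF k p] by auto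
    define q s where "q = p div k ^ n" and "s = p mod k ^ n"
    have kn: "k ^ n > 0" using k0 by simp
    have q: "q < k" using n(2) by (simp add: q_def less_mult_imp_div_less)
    have s: "s < k ^ n" and pqs: "p = k ^ n * q + s" using kn by (auto simp: q_def s_def)
    have "y i = y (i + p)" for i
    proof -
      define a b where "a = i div k ^ n" and "b = i mod k ^ n"
      have b: "b < k ^ n" and iab: "i = k ^ n * a + b" using kn by (auto simp: a_def b_def)
      \<comment> \<open>Block \<open>a\<close> is replaced by an early block \<open>a'\<close> with
        the same window. As \<open>k ^ n \<le> p\<close>, its positions lie below
        \<open>L * p\<close>, where the period is assumed.\<close>
      obtain a' where a': "a' < L" "f a' = f a" using L by blast
      define u v where "u = q + (b + s) div k ^ n" and "v = (b + s) mod k ^ n"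
      have "(b + s) div k ^ n < 2" using b s by (intro less_mult_imp_div_less) simp
      then have u: "u \<le> k" using q by (simp add: u_def)
      have v: "v < k ^ n" using kn by (simp add: v_def)
      have uv: "k ^ n * c + b + p = k ^ n * (c + u) + v" for c
      proof -
        have "b + s = k ^ n * ((b + s) div k ^ n) + v" by (simp add: v_def)
        then show ?thesis by (simp add: pqs u_def algebra_simps)
      qed
      have "k ^ n * (a' + 1) \<le> p * L" using a'(1) n(1) by (intro mult_le_mono) auto
      then have "k ^ n * a' + b < L * p" using b by (simp add: algebra_simps)
      then have "y (k ^ n * a' + b) = y (k ^ n * a' + b + p)" using per by blast
      moreover have "y (k ^ n * a' + b) = y (k ^ n * a + b)"
        using G[OF b] f_eq[OF a'(2), of 0] by simp
      moreover have "y (k ^ n * a' + b + p) = y (k ^ n * a + b + p)"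
        unfolding uv using G[OF v] f_eq[OF a'(2) u] by simp
      ultimately show ?thesis by (simp add: iab)
    qed
    then have "shiftn p y = y" by (auto simp: fun_eq_iff)
    then show False using np p by (auto simp: periodic_seq_def)
  qed
  moreover from this[of 1] have "L > 0" by (cases L) auto
  ultimately show thesis using that by blast
qed

subsection \<open>The system of a substitution of constant length\<close>

lemma sublist_iff_nth:
  "sublist xs ys \<longleftrightarrow> (\<exists>s. s + length xs \<le> length ys \<and> (\<forall>i<length xs. xs ! i = ys ! (s + i)))"
proof
  assume "sublist xs ys"
  then obtain us vs where "ys = us @ xs @ vs" by (auto simp: sublist_def)
  then show "\<exists>s. s + length xs \<le> length ys \<and> (\<forall>i<length xs. xs ! i = ys ! (s + i))"
    by (intro exI[of _ "length us"]) (auto simp: nth_append)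
next
  assume "\<exists>s. s + length xs \<le> length ys \<and> (\<forall>i<length xs. xs ! i = ys ! (s + i))"
  then obtain s where s: "s + length xs \<le> length ys" "\<forall>i<length xs. xs ! i = ys ! (s + i)" by blast
  then have "xs = take (length xs) (drop s ys)" by (intro nth_equalityI) auto
  moreover have "sublist (take (length xs) (drop s ys)) ys"
    by (meson sublist_drop sublist_order.order.trans sublist_take)
  ultimately show "sublist xs ys" by simp
qed

locale const_length_subst =
  fixes k :: nat and \<phi> :: "'a::finite \<Rightarrow> 'a list"
  assumes k_ge_2: "k \<ge> 2" and const_length: "const_length k \<phi>"
begin

abbreviation \<Phi> :: "nat \<Rightarrow> (nat \<Rightarrow> 'a) \<Rightarrow> nat \<Rightarrow> 'a" where
  "\<Phi> n \<equiv> subst_seq k \<phi> ^^ n"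

abbreviation X :: "(nat \<Rightarrow> 'a) set" where
  "X \<equiv> subst_system \<phi>"

lemma k_pos: "k > 0" using k_ge_2 by simp

lemma less_power_k: "i < k ^ i"
  using k_ge_2 by (simp add: power_gt_expt)

text \<open>Testing prefixes suffices, since every factor lies inside a prefix; this turns
  membership into equations between letters.\<close>

lemma mem_system_iff:
  "x \<in> X \<longleftrightarrow> (\<forall>N. \<exists>a n s. s + N \<le> k ^ n \<and> (\<forall>i<N. x i = \<Phi> n (\<lambda>_. a) (s + i)))"
    (is "_ \<longleftrightarrow> (\<forall>N. ?P N)")
proof
  assume x: "x \<in> X"
  show "\<forall>N. ?P N"
  proof
    fix N
    obtain a n where "sublist (factor_of x 0 N) (subst_word_pow \<phi> n a)"
      using x unfolding subst_system_def by blast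
    then obtain s where s: "s + N \<le> length (subst_word_pow \<phi> n a)"
      "\<forall>i<N. x i = subst_word_pow \<phi> n a ! (s + i)"
      by (auto simp: sublist_iff_nth factor_of_def)
    then show "?P N"
      using subst_word_pow_nth[OF const_length k_pos, of n a]
      by (intro exI[of _ a] exI[of _ n] exI[of _ s]) auto
  qed
next
  assume P: "\<forall>N. ?P N"
  show "x \<in> X"
    unfolding subst_system_def
  proof (intro CollectI allI)
    fix i j
    obtain a n s where s: "s + (i + (j - i)) \<le> k ^ n"
      "\<forall>t<i + (j - i). x t = \<Phi> n (\<lambda>_. a) (s + t)"
      using P by blast
    then have "sublist (factor_of x i j) (subst_word_pow \<phi> n a)"
      using subst_word_pow_nth[OF const_length k_pos, of n a]
      by (auto simp: sublist_iff_nth factor_of_def add.assoc intro!: exI[of _ "s + i"])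
    then show "\<exists>a n. sublist (factor_of x i j) (subst_word_pow \<phi> n a)" by blast
  qed
qed

lemma system_closed:
  assumes "\<And>n. \<exists>x'\<in>X. agree n x x'"
  shows "x \<in> X"
  unfolding mem_system_iff
proof
  fix N
  obtain x' where x': "x' \<in> X" "agree N x x'" using assms by blast
  then show "\<exists>a n s. s + N \<le> k ^ n \<and> (\<forall>i<N. x i = \<Phi> n (\<lambda>_. a) (s + i))"
    unfolding mem_system_iff agree_def by metis
qed

lemma system_shiftn:
  assumes "x \<in> X" shows "shiftn p x \<in> X"
  unfolding mem_system_iff
proof
  fix N
  obtain a n s where "s + (N + p) \<le> k ^ n" "\<forall>i<N + p. x i = \<Phi> n (\<lambda>_. a) (s + i)"
    using assms mem_system_iff by metis
  then show "\<exists>a n s. s + N \<le> k ^ n \<and> (\<forall>i<N. shiftn p x i = \<Phi> n (\<lambda>_. a) (s + i))"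
    by (intro exI[of _ a] exI[of _ n] exI[of _ "s + p"]) (auto simp: ac_simps)
qed

lemma system_subst:
  assumes "x \<in> X" shows "subst_seq k \<phi> x \<in> X"
  unfolding mem_system_iff
proof
  fix N
  obtain a n s where s: "s + N \<le> k ^ n" "\<forall>i<N. x i = \<Phi> n (\<lambda>_. a) (s + i)"
    using assms mem_system_iff by metis
  have "k * s + N \<le> k * (s + N)" using k_pos by (simp add: algebra_simps)
  also have "\<dots> \<le> k * k ^ n" using s(1) by simp
  finally have "k * s + N \<le> k ^ Suc n" by simp
  moreover have "subst_seq k \<phi> x i = \<Phi> (Suc n) (\<lambda>_. a) (k * s + i)" if "i < N" for i
  proof -
    have "i div k < N" using that div_le_dividend le_less_trans by blast
    moreover have "(k * s + i) div k = s + i div k" using k_pos by simp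
    ultimately show ?thesis using s(2) by (simp add: subst_seq_apply)
  qed
  ultimately show "\<exists>a n s. s + N \<le> k ^ n \<and> (\<forall>i<N. subst_seq k \<phi> x i = \<Phi> n (\<lambda>_. a) (s + i))"
    by blast
qed

lemma system_subst_pow: "x \<in> X \<Longrightarrow> \<Phi> n x \<in> X"
  by (induction n) (auto intro: system_subst)

text \<open>Every prefix of \<open>x\<close> can be desubstituted. The pigeonhole principle fixes
  one phase \<open>e\<close> for all lengths, and a cluster point of the approximate preimages is an
  exact one.\<close>

lemma desubstitute:
  assumes "x \<in> X"
  shows "\<exists>w\<in>X. \<exists>e<k. x = shiftn e (subst_seq k \<phi> w)"
proof -
  define P where "P N e w \<longleftrightarrow> (\<forall>i<N. x i = \<phi> (w ((e + i) div k)) ! ((e + i) mod k)) \<and>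
    (\<exists>a n s. s + N div k \<le> k ^ n \<and> (\<forall>i<N div k. w i = \<Phi> n (\<lambda>_. a) (s + i)))" for N e w
  have P_antimono: "P M e w" if PN: "P N e w" and MN: "M \<le> N" for M N e w
  proof -
    obtain a n s where "s + N div k \<le> k ^ n" "\<forall>i<N div k. w i = \<Phi> n (\<lambda>_. a) (s + i)"
      using PN unfolding P_def by blast
    moreover have "M div k \<le> N div k" using MN by (rule div_le_mono)
    ultimately have "s + M div k \<le> k ^ n \<and> (\<forall>i<M div k. w i = \<Phi> n (\<lambda>_. a) (s + i))" by auto
    then show ?thesis using PN MN unfolding P_def by (meson less_le_trans)
  qed
  have ex: "\<exists>e<k. \<exists>w. P N e w" for N
  proof -
    \<comment> \<open>The two extra letters exclude \<open>n = 0\<close>, so that one application of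
      the substitution can be undone.\<close>
    obtain a n s where s: "s + (N + 2) \<le> k ^ n" "\<forall>i<N + 2. x i = \<Phi> n (\<lambda>_. a) (s + i)"
      using assms mem_system_iff by metis
    have "n \<noteq> 0" using s(1) by (intro notI) simp
    then obtain n' where n': "n = Suc n'" using not0_implies_Suc by blast
    define q e where "q = s div k" and "e = s mod k"
    have sqe: "s = k * q + e" by (simp add: q_def e_def)
    define w where "w i = \<Phi> n' (\<lambda>_. a) (q + i)" for i
    have 1: "x i = \<phi> (w ((e + i) div k)) ! ((e + i) mod k)" if "i < N" for i
    proof -
      have "s + i = k * q + (e + i)" by (simp add: sqe)
      then have "(s + i) div k = q + (e + i) div k" "(s + i) mod k = (e + i) mod k"
        using k_pos by (simp_all only: div_mult_self4 mod_mult_self4)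
      then show ?thesis using s(2) that by (simp add: n' subst_seq_apply w_def)
    qed
    have "k * (q + N div k) \<le> s + N" 
      by (simp add: sqe distrib_left trans_le_add2)
    also have "\<dots> \<le> k * k ^ n'" using s(1) n' by simp
    finally have "q + N div k \<le> k ^ n'" using k_pos by simp
    then have "P N e w" unfolding P_def using 1 w_def by blast
    moreover have "e < k" using k_pos by (simp add: e_def)
    ultimately show ?thesis by blast
  qed
  have "\<exists>ee. \<forall>N. ee N < k \<and> (\<exists>w. P N (ee N) w)" by (rule choice) (use ex in blast)
  then obtain ee where ee: "\<And>N. ee N < k \<and> (\<exists>w. P N (ee N) w)" by blast
  have "range ee \<subseteq> {..<k}" using ee by blast
  then have "finite (range ee)" using finite_subset by blast
  then obtain e where e: "infinite {N\<in>UNIV. ee N = e}"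
    using infinite_fibre[of ee UNIV] by auto
  have "\<exists>w. P N e w" for N
  proof -
    obtain N' where "N' \<ge> N" "ee N' = e"
      using e by (metis (mono_tags, lifting) infinite_nat_iff_unbounded_le mem_Collect_eq)
    then show ?thesis using ee P_antimono by blast
  qed
  then have "\<exists>ww. \<forall>N. P N e (ww N)" by (intro choice) blast
  then obtain ww where ww: "\<And>N. P N e (ww N)" by blast
  obtain w where w: "\<And>n m. \<exists>N\<ge>m. agree n w (ww N)" using sequence_cluster_point by blast
  have ek: "e < k" using e ee by (metis (mono_tags, lifting) Collect_empty_eq finite.emptyI)
  have "w \<in> X"
    unfolding mem_system_iff
  proof
    fix M
    obtain N where N: "N \<ge> k * M" "agree M w (ww N)" using w by blast
    have "P (k * M) e (ww N)" using ww P_antimono N(1) by blast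
    then show "\<exists>a n s. s + M \<le> k ^ n \<and> (\<forall>i<M. w i = \<Phi> n (\<lambda>_. a) (s + i))"
      using N(2) k_pos by (simp add: P_def agree_def)
  qed
  moreover have "x = shiftn e (subst_seq k \<phi> w)"
  proof
    fix i
    obtain N where N: "N \<ge> Suc i" "agree (Suc (e + i)) w (ww N)" using w by blast
    have "(e + i) div k < Suc (e + i)" using div_le_dividend less_Suc_eq_le by blast
    then have "w ((e + i) div k) = ww N ((e + i) div k)" using N(2) by (simp add: agree_def)
    moreover have "x i = \<phi> (ww N ((e + i) div k)) ! ((e + i) mod k)"
      using ww[of N] N(1) by (simp add: P_def)
    ultimately show "x i = shiftn e (subst_seq k \<phi> w) i"
      by (simp add: subst_seq_apply add.commute)
  qed
  ultimately show ?thesis using ek by blast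
qed

lemma desubstitute_pow:
  assumes "x \<in> X"
  shows "\<exists>w\<in>X. \<exists>e<k ^ n. x = shiftn e (\<Phi> n w)"
proof (induction n)
  case 0
  show ?case using assms by (intro bexI[of _ x] exI[of _ 0]) (auto simp: fun_eq_iff)
next
  case (Suc n)
  then obtain w e where w: "w \<in> X" "e < k ^ n" "x = shiftn e (\<Phi> n w)" by blast
  obtain w' e' where w': "w' \<in> X" "e' < k" "w = shiftn e' (subst_seq k \<phi> w')"
    using desubstitute[OF w(1)] by blast
  have "x = shiftn (e + k ^ n * e') (\<Phi> (Suc n) w')"
    unfolding w(3) w'(3) subst_pow_shiftn[OF k_pos] shiftn_shiftn funpow_Suc_right by simp
  moreover have "e + k ^ n * e' < k ^ Suc n"
  proof -
    have "k ^ n * (e' + 1) \<le> k ^ n * k" using w'(2) by (intro mult_le_mono) auto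
    then show ?thesis using w(2) by (simp add: algebra_simps)
  qed
  ultimately show ?case using w'(1) by blast
qed

text \<open>Applying \<open>\<Phi> (n' - n)\<close> to the first representation shows that
  \<open>x\<close> and its image are both tails of \<open>\<Phi> n' v\<close>.\<close>

lemma quasi_fixed_if_repeated:
  assumes "x = shiftn d (\<Phi> n v)" "x = shiftn d' (\<Phi> n' v)" "n < n'"
  shows "quasi_fixed k \<phi> x"
proof (rule quasi_fixedI[OF assms(2), where m = "n' - n" and b = "k ^ (n' - n) * d"])
  have "\<Phi> (n' - n) x = \<Phi> (n' - n) (shiftn d (\<Phi> n v))"
    by (rule arg_cong[of _ _ "\<Phi> (n' - n)"]) (rule assms(1))
  also have "\<dots> = shiftn (k ^ (n' - n) * d) (\<Phi> (n' - n) (\<Phi> n v))"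
    by (rule subst_pow_shiftn[OF k_pos])
  also have "\<Phi> (n' - n) (\<Phi> n v) = \<Phi> n' v"
    using assms(3) funpow_add[of "n' - n" n "subst_seq k \<phi>"] by simp
  finally show "\<Phi> (n' - n) x = shiftn (k ^ (n' - n) * d) (\<Phi> n' v)" .
qed (use assms(3) in simp)

lemma desubstitution_sequence:
  assumes "x \<in> X"
  obtains w d where "\<And>n. w n \<in> X" "\<And>n. d n < k ^ n" "\<And>n. x = shiftn (d n) (\<Phi> n (w n))"
proof -
  have "\<exists>f. \<forall>n. fst (f n) \<in> X \<and> snd (f n) < k ^ n \<and> x = shiftn (snd (f n)) (\<Phi> n (fst (f n)))"
  proof (rule choice, rule allI)
    fix n
    obtain w e where "w \<in> X" "e < k ^ n" "x = shiftn e (\<Phi> n w)"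
      using desubstitute_pow[OF assms] by blast
    then show "\<exists>p. fst p \<in> X \<and> snd p < k ^ n \<and> x = shiftn (snd p) (\<Phi> n (fst p))"
      by (intro exI[of _ "(w, e)"]) auto
  qed
  then obtain f where "\<And>n. fst (f n) \<in> X \<and> snd (f n) < k ^ n \<and> x = shiftn (snd (f n)) (\<Phi> n (fst (f n)))"
    by blast
  then show thesis using that[of "\<lambda>n. fst (f n)" "\<lambda>n. snd (f n)"] by blast
qed

lemma subst_pow_first: "\<Phi> n v 0 = ((\<lambda>a. \<phi> a ! 0) ^^ n) (v 0)"
  by (induction n) (simp_all add: subst_seq_apply[of k \<phi> "\<Phi> _ v" 0])

text \<open>The Curtis-Hedlund-Lyndon argument. Pairs with ever longer common prefixes but different
  images at 0 would cluster at a point of \<open>X\<close> where continuity fails. Commutation with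
  the shift carries the window from coordinate 0 to all others.\<close>

lemma factor_map_block_code:
  assumes "factor_map X Y \<pi>"
  obtains r where "\<And>x x' i i'. x \<in> X \<Longrightarrow> x' \<in> X \<Longrightarrow> (\<And>j. j < r \<Longrightarrow> x (i + j) = x' (i' + j)) \<Longrightarrow>
    \<pi> x i = \<pi> x' i'"
proof -
  have cont: "seq_continuous_on X \<pi>" and comm: "\<And>x. x \<in> X \<Longrightarrow> \<pi> (shift x) = shift (\<pi> x)"
    using assms by (auto simp: factor_map_def)
  have "\<exists>r. \<forall>x\<in>X. \<forall>x'\<in>X. agree r x x' \<longrightarrow> \<pi> x 0 = \<pi> x' 0"
  proof (rule ccontr)
    assume "\<not> ?thesis"
    then obtain u u' where u: "\<And>N. u N \<in> X \<and> u' N \<in> X \<and> agree N (u N) (u' N) \<and> \<pi> (u N) 0 \<noteq> \<pi> (u' N) 0"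
      by metis
    obtain v where v: "\<And>n m. \<exists>N\<ge>m. agree n v (u N)" using sequence_cluster_point by blast
    have "v \<in> X" using v u by (intro system_closed) blast
    then obtain m where m: "\<And>x'. x' \<in> X \<Longrightarrow> agree m v x' \<Longrightarrow> agree 1 (\<pi> v) (\<pi> x')"
      using cont unfolding seq_continuous_on_def by blast
    obtain N where N: "N \<ge> m" "agree m v (u N)" using v by blast
    then have "agree m v (u' N)" using u[of N] by (auto simp: agree_def)
    then have "agree 1 (\<pi> v) (\<pi> (u N))" "agree 1 (\<pi> v) (\<pi> (u' N))" using m N(2) u by auto
    then show False using u[of N] by (auto simp: agree_def)
  qed
  then obtain r where r: "\<And>x x'. x \<in> X \<Longrightarrow> x' \<in> X \<Longrightarrow> agree r x x' \<Longrightarrow> \<pi> x 0 = \<pi> x' 0" by blast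
  have pi_shiftn: "\<pi> x i = \<pi> (shiftn i x) 0" if "x \<in> X" for x i
    using that
  proof (induction i arbitrary: x)
    case 0
    have "shiftn 0 x = x" by (simp add: fun_eq_iff)
    then show ?case by simp
  next
    case (Suc i)
    have sx: "shift x = shiftn 1 x" by (simp add: fun_eq_iff shift_def)
    have "\<pi> x (Suc i) = \<pi> (shift x) i" using comm[OF Suc.prems] by (simp add: shift_def)
    also have "\<dots> = \<pi> (shiftn i (shiftn 1 x)) 0"
      unfolding sx by (rule Suc.IH[OF system_shiftn[OF Suc.prems]])
    also have "shiftn i (shiftn 1 x) = shiftn (Suc i) x" by (simp add: fun_eq_iff)
    finally show ?case .
  qed
  show thesis
  proof
    fix x x' i i' assume *: "x \<in> X" "x' \<in> X" "\<And>j. j < r \<Longrightarrow> x (i + j) = x' (i' + j)"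
    then have "agree r (shiftn i x) (shiftn i' x')" by (simp add: agree_def add.commute)
    then show "\<pi> x i = \<pi> x' i'"
      using r[OF system_shiftn[OF *(1)] system_shiftn[OF *(2)]] pi_shiftn * by simp
  qed
qed

end

locale subst_block_code = const_length_subst k \<phi>
  for k :: nat and \<phi> :: "'a::finite \<Rightarrow> 'a list" +
  fixes \<pi> :: "(nat \<Rightarrow> 'a) \<Rightarrow> nat \<Rightarrow> 'b::finite" and r :: nat
  assumes block_code: "\<lbrakk>x \<in> X; x' \<in> X; \<And>j. j < r \<Longrightarrow> x (i + j) = x' (i' + j)\<rbrakk> \<Longrightarrow> \<pi> x i = \<pi> x' i'"
begin

lemma code_shiftn:
  assumes "x \<in> X" shows "\<pi> (shiftn p x) = shiftn p (\<pi> x)"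
proof
  fix i
  have "\<pi> (shiftn p x) i = \<pi> x (i + p)"
    using assms system_shiftn by (intro block_code) (auto simp: ac_simps)
  then show "\<pi> (shiftn p x) i = shiftn p (\<pi> x) i" by simp
qed

subsection \<open>Images of quasi-fixed points are automatic\<close>

text \<open>The functions whose value at \<open>i\<close> is determined by the window of \<open>x\<close> of radius \<open>S\<close>
  around \<open>i\<close> (for \<open>i \<ge> S\<close>, with arbitrary values before) form a finite set, which is stable
  under decimation by \<open>k ^ m\<close> because \<open>T\<^sup>a \<phi>\<^sup>m x = T\<^sup>b x\<close> contracts windows.\<close>

lemma automatic_if_quasi_fixed:
  assumes x: "x \<in> X" and qf: "quasi_fixed k \<phi> x"
  shows "automatic k (\<pi> x)"
proof -
  obtain m a b where m: "m \<ge> 1" and ab: "shiftn a (\<Phi> m x) = shiftn b x"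
    using quasi_fixedE[OF qf] by metis
  define K where "K = k ^ m"
  have "k ^ 1 \<le> k ^ m" using k_pos m by (intro power_increasing) auto
  then have K: "K \<ge> 2" using k_ge_2 by (simp add: K_def)
  \<comment> \<open>Large enough for the shifts \<open>a\<close> and \<open>b\<close> in the
    quasi-fixed relation and for the window \<open>r\<close> of the code. \<open>W u\<close> starts
    at \<open>u\<close> and is centred at \<open>u + S\<close>, which avoids negative
    indices.\<close>
  define S where "S = a + b + r"
  define W where "W u = map (\<lambda>s. x (u + s)) [0..<Suc (2 * S)]" for u
  have W_iff: "W u = W u' \<longleftrightarrow> (\<forall>s\<le>2 * S. x (u + s) = x (u' + s))" for u u'
    by (auto simp: W_def simp del: upt_Suc)
  define F :: "(nat \<Rightarrow> 'b) set" where "F = {f. \<forall>u u'. W u = W u' \<longrightarrow> f (u + S) = f (u' + S)}"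
  show ?thesis
  proof (rule automatic_if_power_decimation_closed[of F _ k m])
    have "range W \<subseteq> {l. set l \<subseteq> UNIV \<and> length l = Suc (2 * S)}" by (auto simp: W_def)
    then have "finite (range W)"
      by (rule finite_subset) (rule finite_lists_length_eq[OF finite])
    then obtain L where L: "\<And>u. \<exists>u'<L. W u' = W u" using finite_range_initial_segment by blast
    \<comment> \<open>All windows already start below \<open>L\<close>, so a member of
      \<open>F\<close> is determined by its first \<open>L + S\<close> values.\<close>
    have "inj_on (\<lambda>f. restrict f {..<L + S}) F"
    proof (rule inj_onI)
      fix f g assume fg: "f \<in> F" "g \<in> F" "restrict f {..<L + S} = restrict g {..<L + S}"
      then have eq: "f i = g i" if "i < L + S" for i
        using that by (metis lessThan_iff restrict_apply')
      show "f = g"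
      proof
        fix i
        show "f i = g i"
        proof (cases "i < S")
          case False
          then obtain u where u: "i = u + S" by (metis add.commute le_Suc_ex not_less)
          obtain u' where u': "u' < L" "W u' = W u" using L by blast
          have "f (u' + S) = f i" "g (u' + S) = g i"
            using fg(1,2) u'(2) unfolding F_def u by blast+
          then show ?thesis using eq[of "u' + S"] u'(1) by simp
        qed (simp add: eq)
      qed
    qed
    moreover have "(\<lambda>f. restrict f {..<L + S}) ` F \<subseteq> {..<L + S} \<rightarrow>\<^sub>E UNIV"
      by (auto split: if_splits)
    moreover have "finite ({..<L + S} \<rightarrow>\<^sub>E (UNIV :: 'b set))" by (intro finite_PiE) auto
    ultimately show "finite F" using inj_on_finite by blast
  next
    show "\<pi> x \<in> F"
      unfolding F_def W_iff
    proof (intro CollectI allI impI)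
      fix u u' assume "\<forall>s\<le>2 * S. x (u + s) = x (u' + s)"
      moreover have "S + j \<le> 2 * S" if "j < r" for j using that by (simp add: S_def)
      ultimately show "\<pi> x (u + S) = \<pi> x (u' + S)"
        using x by (intro block_code) (auto simp: add.assoc)
    qed
  next
    fix f j assume f: "f \<in> F" and j: "j < k ^ m"
    show "(\<lambda>i. f (k ^ m * i + j)) \<in> F"
      unfolding F_def
    proof (intro CollectI allI impI)
      fix u u' assume W: "W u = W u'"
      obtain K' where K': "K = Suc K'" "K' \<ge> 1" using K by (cases K) auto
      \<comment> \<open>The window centred at \<open>K * (u + S) + j\<close> starts at
        \<open>K * u + c\<close>. The relation \<open>ab\<close> reads it off
        \<open>\<Phi> m x\<close> from \<open>K * u + t\<close> on, with
        \<open>t < (2 * S + 1) * K\<close>; there only the window of \<open>x\<close> at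
        \<open>u\<close> matters.\<close>
      define c where "c = K' * S + j"
      have SK: "S \<le> K' * S" using K'(2) by simp
      have "x (K * u + c + s) = x (K * u' + c + s)" if s: "s \<le> 2 * S" for s
      proof -
        define t where "t = c + s + a - b"
        have bS: "b \<le> S" by (simp add: S_def)
        then have cb: "b \<le> c" using SK unfolding c_def by linarith
        have xv: "x (K * v + c + s) = \<Phi> m x (K * v + t)" for v
        proof -
          have "shiftn a (\<Phi> m x) (K * v + c + s - b) = shiftn b x (K * v + c + s - b)"
            using ab by simp
          moreover have "K * v + c + s - b + a = K * v + t" using cb by (simp add: t_def)
          ultimately show ?thesis using cb by simp
        qed
        have "t \<le> K' * S + j + 2 * S + S" using s by (simp add: t_def c_def S_def)
        also have "\<dots> < K' * S + K + 2 * S + K' * S" using j SK unfolding K_def by linarith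
        also have "\<dots> = Suc (2 * S) * K" by (simp add: K' algebra_simps)
        finally have "t < Suc (2 * S) * k ^ m" by (simp add: K_def)
        then show ?thesis
          unfolding xv unfolding K_def
          using W by (intro subst_pow_window[OF k_pos, of "Suc (2 * S)"]) (auto simp: W_iff)
      qed
      then have "W (K * u + c) = W (K * u' + c)" by (simp add: W_iff)
      then have "f (K * u + c + S) = f (K * u' + c + S)" using f unfolding F_def by blast
      moreover have "K * v + c + S = K * (v + S) + j" for v
        by (simp add: c_def K' algebra_simps)
      ultimately show "f (k ^ m * (u + S) + j) = f (k ^ m * (u' + S) + j)"
        by (simp add: K_def)
    qed
  qed (use k_pos m in auto)
qed

subsection \<open>Fibres over nonperiodic automatic sequences\<close>

text \<open>Finitely many points of the fibre are desubstituted to one high level \<open>N\<close>,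
  with phases \<open>D x < k ^ N\<close>. If two of them share the first two letters of
  \<open>w\<close>, the difference of their phases is a period of a long prefix of \<open>y\<close>,
  hence at least \<open>k ^ N / c\<close>. This bounds the number of points by \<open>c\<close>
  times the number of letter pairs.\<close>

lemma finite_desubstituted_fibre:
  assumes aut: "automatic k y" and np: "\<not> periodic_seq y" and d: "d < k ^ n"
  shows "finite {x\<in>X. \<pi> (shiftn d (\<Phi> n x)) = y}" (is "finite ?S")
proof (rule ccontr)
  assume inf: "infinite ?S"
  obtain C where C: "C > 0" "\<And>p. p \<ge> 1 \<Longrightarrow> \<exists>i<C * p. y i \<noteq> y (i + p)"
    using automatic_nonperiodic_prefix[OF aut k_ge_2 np] by metis
  \<comment> \<open>The factor 2 absorbs the window width, because \<open>2 * r \<le> k ^ N\<close>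
    below.\<close>
  define c where "c = 2 * C"
  obtain F where F: "finite F" "card F = Suc (card ({..<c} \<times> (UNIV :: ('a \<times> 'a) set)))" "F \<subseteq> ?S"
    using infinite_arbitrarily_large[OF inf, of "Suc (card ({..<c} \<times> (UNIV :: ('a \<times> 'a) set)))"]
    by blast
  obtain L where L: "\<And>x x'. x \<in> F \<Longrightarrow> x' \<in> F \<Longrightarrow> (\<And>i. i < L \<Longrightarrow> x i = x' i) \<Longrightarrow> x = x'"
  proof -
    define D where "D = (\<lambda>(x, x'). LEAST i. x i \<noteq> x' i) ` (F \<times> F)"
    have "finite D" using F(1) by (simp add: D_def)
    then obtain L where L: "\<And>i. i \<in> D \<Longrightarrow> i < L" using finite_nat_set_iff_bounded by metis
    have "x = x'" if "x \<in> F" "x' \<in> F" "\<And>i. i < L \<Longrightarrow> x i = x' i" for x x'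
    proof (rule ccontr)
      assume "x \<noteq> x'"
      then have "\<exists>i. x i \<noteq> x' i" by auto
      then have "x (LEAST i. x i \<noteq> x' i) \<noteq> x' (LEAST i. x i \<noteq> x' i)" by (rule LeastI_ex)
      moreover have "(LEAST i. x i \<noteq> x' i) \<in> D" using that(1,2) by (force simp: D_def)
      ultimately show False using L that(3) by blast
    qed
    then show thesis using that by blast
  qed
  \<comment> \<open>Chosen so that \<open>k ^ l\<close> exceeds both the length \<open>L\<close>,
    which separates the points of \<open>F\<close>, and \<open>2 * r\<close>.\<close>
  define l where "l = L + 2 * r"
  define N where "N = n + l"
  have lL: "L \<le> k ^ l" using less_power_k[of l] by (simp add: l_def)
  have "k ^ l \<le> k ^ N" using k_pos by (intro power_increasing) (auto simp: N_def)
  then have Nr: "2 * r \<le> k ^ N" using less_power_k[of l] by (simp add: l_def)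
  have kN: "k ^ N > 0" using k_pos by simp
  have "\<forall>x. \<exists>w e. x \<in> X \<longrightarrow> w \<in> X \<and> e < k ^ l \<and> x = shiftn e (\<Phi> l w)"
    using desubstitute_pow by blast
  then obtain w e where we: "\<And>x. x \<in> X \<Longrightarrow> w x \<in> X \<and> e x < k ^ l \<and> x = shiftn (e x) (\<Phi> l (w x))"
    by metis
  define D where "D x = d + k ^ n * e x" for x
  have D: "\<pi> (shiftn (D x) (\<Phi> N (w x))) = y" if "x \<in> F" for x
  proof -
    have xX: "x \<in> X" and "\<pi> (shiftn d (\<Phi> n x)) = y" using that F(3) by auto
    moreover have "\<Phi> n x = shiftn (k ^ n * e x) (\<Phi> N (w x))"
    proof -
      have "\<Phi> n x = \<Phi> n (shiftn (e x) (\<Phi> l (w x)))"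
        by (rule arg_cong[of _ _ "\<Phi> n"]) (use we[OF xX] in blast)
      then show ?thesis unfolding subst_pow_shiftn[OF k_pos] N_def funpow_add o_apply .
    qed
    ultimately show ?thesis unfolding D_def shiftn_shiftn[symmetric] by simp
  qed
  have D_less: "D x < k ^ N" if "x \<in> F" for x
  proof -
    have "e x < k ^ l" using that F(3) we by auto
    then have "k ^ n * (e x + 1) \<le> k ^ n * k ^ l" by (intro mult_le_mono) auto
    then show ?thesis using d by (simp add: D_def N_def power_add)
  qed
  have sep: "k ^ N \<le> c * (D x' - D x)"
    if x: "x \<in> F" "x' \<in> F" "w x 0 = w x' 0" "w x 1 = w x' 1" "D x < D x'" for x x'
  proof -
    define p where "p = D x' - D x"
    have D': "D x' = D x + p" and p: "p \<ge> 1" using x(5) by (auto simp: p_def)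
    have X: "shiftn (D v) (\<Phi> N (w v)) \<in> X" if "v \<in> F" for v
      using that F(3) we by (intro system_shiftn system_subst_pow) auto
    have w2: "w x t = w x' t" if "t < 2" for t using that x(3,4) by (auto simp: less_2_cases_iff)
    \<comment> \<open>The letters read stay within the first \<open>2 * k ^ N\<close> letters of the
      image, where \<open>w x\<close> and \<open>w x'\<close> give the same word. So
      \<open>y\<close> is seen twice in this word, at distance \<open>p\<close>.\<close>
    have per: "y i = y (i + p)" if i: "i + r \<le> k ^ N" for i
    proof -
      have "\<pi> (shiftn (D x') (\<Phi> N (w x'))) i = \<pi> (shiftn (D x) (\<Phi> N (w x))) (i + p)"
      proof (rule block_code[OF X[OF x(2)] X[OF x(1)]])
        fix j assume j: "j < r"
        have "i + j + D x' < 2 * k ^ N" using j i D_less[OF x(2)] by simp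
        then have "\<Phi> N (w x) (i + j + D x') = \<Phi> N (w x') (i + j + D x')"
          using w2 by (intro subst_pow_prefix[OF k_pos])
        then show "shiftn (D x') (\<Phi> N (w x')) (i + j) = shiftn (D x) (\<Phi> N (w x)) (i + p + j)"
          by (simp add: D' ac_simps)
      qed
      then show ?thesis using D x by simp
    qed
    obtain i where "i < C * p" "y i \<noteq> y (i + p)" using C(2)[OF p] by blast
    then have "k ^ N < C * p + r" using per[of i] by (cases "i + r \<le> k ^ N") auto
    then show ?thesis using Nr by (simp add: c_def p_def)
  qed
  \<comment> \<open>The phases are sorted into \<open>c\<close> intervals of length
    \<open>k ^ N / c\<close>; by \<open>sep\<close>, distinct phases with the same two letters never
    share an interval.\<close>
  define h where "h x = (D x * c div k ^ N, w x 0, w x 1)" for x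
  have h_D: "\<not> D x < D x'" if "x \<in> F" "x' \<in> F" "h x = h x'" for x x'
  proof
    assume less: "D x < D x'"
    then have "k ^ N \<le> c * (D x' - D x)" using that by (intro sep) (auto simp: h_def)
    then have "D x * c + k ^ N \<le> D x' * c" using less
      by (simp add: diff_mult_distrib2 mult.commute le_diff_conv2)
    then have "(D x * c + k ^ N) div k ^ N \<le> D x' * c div k ^ N" by (rule div_le_mono)
    moreover have "(D x * c + k ^ N) div k ^ N = D x * c div k ^ N + 1"
      using kN by (intro div_add_self2) linarith
    ultimately show False using that(3) by (simp add: h_def)
  qed
  have "inj_on h F"
  proof (rule inj_onI)
    fix x x' assume x: "x \<in> F" "x' \<in> F" "h x = h x'"
    then have "D x = D x'" using h_D[of x x'] h_D[of x' x] by simp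
    then have e: "e x = e x'" using k_pos by (simp add: D_def)
    have w2: "w x t = w x' t" if "t < 2" for t using that x(3) by (auto simp: h_def less_2_cases_iff)
    have X: "x \<in> X" "x' \<in> X" using x F(3) by auto
    show "x = x'"
    proof (rule L[OF x(1,2)])
      fix i assume "i < L"
      then have "i + e x < 2 * k ^ l" using lL we[OF X(1)] by simp
      then have "\<Phi> l (w x) (i + e x) = \<Phi> l (w x') (i + e x)"
        using w2 by (intro subst_pow_prefix[OF k_pos])
      then have "shiftn (e x) (\<Phi> l (w x)) i = shiftn (e x') (\<Phi> l (w x')) i" using e by simp
      then show "x i = x' i" using we[OF X(1)] we[OF X(2)] by metis
    qed
  qed
  moreover have "h ` F \<subseteq> {..<c} \<times> UNIV"
  proof -
    have "D x * c div k ^ N < c" if "x \<in> F" for x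
      using D_less[OF that] C(1) by (intro less_mult_imp_div_less) (simp add: c_def)
    then show ?thesis by (auto simp: h_def)
  qed
  ultimately have "card F \<le> card ({..<c} \<times> (UNIV :: ('a \<times> 'a) set))"
    by (intro card_inj_on_le) auto
  then show False using F(2) by simp
qed

text \<open>Whether \<open>T\<^sup>d \<phi>\<^sup>n u\<close> maps to \<open>y\<close> depends only on the finite set of letters
  \<open>(u\<^sub>i, u\<^sub>i\<^sub>+\<^sub>1, u\<^sub>i\<^sub>+\<^sub>2, z\<^sub>i)\<close>, where \<open>z\<close> codes the blocks of \<open>y\<close>. Two levels \<open>n\<close> with the same set thus
  have their desubstitutions in one and the same finite fibre.\<close>

lemma quasi_fixed_if_automatic_nonperiodic:
  assumes x: "x \<in> X" and aut: "automatic k (\<pi> x)" and np: "\<not> periodic_seq (\<pi> x)"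
  shows "quasi_fixed k \<phi> x"
proof -
  define y where "y = \<pi> x"
  obtain w d where w: "\<And>n. w n \<in> X" and d: "\<And>n. d n < k ^ n"
    and xw: "\<And>n. x = shiftn (d n) (\<Phi> n (w n))"
    using desubstitution_sequence[OF x] by blast
  obtain z :: "nat \<Rightarrow> nat" and G where fin: "finite (range z)"
    and G: "\<And>n a b. b < k ^ n \<Longrightarrow> y (k ^ n * a + b) = G n b (z a)"
    using automatic_blocks[OF aut k_pos] y_def by blast
  \<comment> \<open>Three letters suffice: offset in the block, phase and code window are each
    bounded by \<open>k ^ n\<close>. The last bound is why only levels \<open>n \<ge> r\<close> are
    used.\<close>
  define quad where "quad u = range (\<lambda>i. (u i, u (i + 1), u (i + 2), z i))" for u :: "nat \<Rightarrow> 'a"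
  have "quad u \<in> Pow (UNIV \<times> UNIV \<times> UNIV \<times> range z)" for u by (auto simp: quad_def)
  then have "(\<lambda>n. quad (w n)) ` {r..} \<subseteq> Pow (UNIV \<times> UNIV \<times> UNIV \<times> range z)" by blast
  moreover have "finite (Pow ((UNIV :: 'a set) \<times> (UNIV :: 'a set) \<times> (UNIV :: 'a set) \<times> range z))"
    using fin by simp
  ultimately have "finite ((\<lambda>n. quad (w n)) ` {r..})" by (rule finite_subset)
  then obtain E where inf: "infinite {n\<in>{r..}. quad (w n) = E}"
    using infinite_fibre[OF _ infinite_Ici] by blast
  define I where "I = {n\<in>{r..}. quad (w n) = E}"
  have "infinite I" using inf by (simp add: I_def)
  then obtain n where n: "n \<in> I" using infinite_imp_nonempty by blast
  have "r \<le> n" using n by (simp add: I_def)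
  then have rn: "r \<le> k ^ n" using less_power_k[of n] by linarith
  have kn: "k ^ n > 0" using k_pos by simp
  \<comment> \<open>The point \<open>w n'\<close> of another level is tested at level
    \<open>n\<close> with phase \<open>d n\<close>. Each of its windows, together with the letter of
    \<open>z\<close>, occurs at some place of \<open>w n\<close>, where the image is known to be
    \<open>y\<close>.\<close>
  have same: "\<pi> (shiftn (d n) (\<Phi> n (w n'))) = y" if n': "n' \<in> I" for n'
  proof
    fix i
    define a b where "a = i div k ^ n" and "b = i mod k ^ n"
    have b: "b < k ^ n" and i: "i = k ^ n * a + b" using kn by (auto simp: a_def b_def)
    have "quad (w n') = quad (w n)" using n n' by (simp add: I_def)
    moreover have "(w n' a, w n' (a + 1), w n' (a + 2), z a) \<in> quad (w n')"
      unfolding quad_def by blast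
    ultimately obtain a' where a': "w n' a = w n a'" "w n' (a + 1) = w n (a' + 1)"
      "w n' (a + 2) = w n (a' + 2)" "z a = z a'"
      unfolding quad_def by blast
    have X: "shiftn (d n) (\<Phi> n (w v)) \<in> X" for v
      using w by (intro system_shiftn system_subst_pow)
    have win: "w n' (a + t) = w n (a' + t)" if "t < 3" for t
    proof -
      have "t = 0 \<or> t = 1 \<or> t = 2" using that by linarith
      then show ?thesis using a'(1-3) by auto
    qed
    have "\<pi> (shiftn (d n) (\<Phi> n (w n'))) (k ^ n * a + b) = \<pi> (shiftn (d n) (\<Phi> n (w n))) (k ^ n * a' + b)"
    proof (rule block_code[OF X X])
      fix j assume "j < r"
      then have "b + j + d n < 3 * k ^ n" using b d[of n] rn by linarith
      then have "\<Phi> n (w n') (k ^ n * a + (b + j + d n)) = \<Phi> n (w n) (k ^ n * a' + (b + j + d n))"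
        using win by (intro subst_pow_window[OF k_pos])
      then show "shiftn (d n) (\<Phi> n (w n')) (k ^ n * a + b + j) = shiftn (d n) (\<Phi> n (w n)) (k ^ n * a' + b + j)"
        by (simp add: add.assoc)
    qed
    also have "\<dots> = y (k ^ n * a' + b)" unfolding y_def xw[of n, symmetric] ..
    also have "\<dots> = y (k ^ n * a + b)" using G[OF b] a'(4) by simp
    finally show "\<pi> (shiftn (d n) (\<Phi> n (w n'))) i = y i" unfolding i .
  qed
  have "w ` I \<subseteq> {u\<in>X. \<pi> (shiftn (d n) (\<Phi> n u)) = y}" using w same by blast
  moreover have "finite {u\<in>X. \<pi> (shiftn (d n) (\<Phi> n u)) = y}"
    using finite_desubstituted_fibre aut np d unfolding y_def by blast
  ultimately have "finite (w ` I)" by (rule finite_subset)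
  then obtain v where "infinite {m\<in>I. w m = v}" using infinite_fibre \<open>infinite I\<close> by blast
  then obtain n1 where n1: "w n1 = v"
    using infinite_imp_nonempty by blast
  obtain n2 where n2: "n2 > n1" "w n2 = v"
    using \<open>infinite {m\<in>I. w m = v}\<close> unfolding infinite_nat_iff_unbounded by blast
  show ?thesis
    by (rule quasi_fixed_if_repeated[OF xw[of n1, unfolded n1] xw[of n2, unfolded n2(2)] n2(1)])
qed

subsection \<open>Fibres over periodic sequences\<close>

text \<open>The letters \<open>v\<^sub>n 0\<close> and the residues of \<open>n\<close> and of the phase are constant along a subsequence,
  along which \<open>\<phi>\<^sup>n v\<^sub>n\<close> converges to a point fixed by \<open>\<phi>\<^sup>Q\<close>.\<close>

lemma quasi_fixed_over_periodic:
  assumes x: "x \<in> X" and per: "periodic_seq (\<pi> x)"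
  shows "\<exists>x'\<in>X. quasi_fixed k \<phi> x' \<and> \<pi> x' = \<pi> x"
proof -
  define y where "y = \<pi> x"
  obtain p where p: "p \<ge> 1" "shiftn p y = y" using per by (auto simp: periodic_seq_def y_def)
  have y_mod: "shiftn s y = shiftn (s mod p) y" for s
  proof -
    have "shiftn (p * t) y = y" for t
    proof (induction t)
      case 0
      show ?case by (simp add: fun_eq_iff)
    next
      case (Suc t)
      have "shiftn (p * Suc t) y = shiftn p (shiftn (p * t) y)" unfolding shiftn_shiftn by simp
      then show ?case using Suc p(2) by metis
    qed
    then have "shiftn (s mod p) y = shiftn (s mod p) (shiftn (p * (s div p)) y)" by metis
    then show ?thesis unfolding shiftn_shiftn by simp
  qed
  obtain w d where w: "\<And>n. w n \<in> X" and d: "\<And>n. d n < k ^ n"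
    and xw: "\<And>n. x = shiftn (d n) (\<Phi> n (w n))"
    using desubstitution_sequence[OF x] by blast
  \<comment> \<open>Dropping the first letter makes \<open>\<Phi> n (v n)\<close> a tail of
    \<open>x\<close>, as \<open>d n < k ^ n\<close>; its image is then a shift of \<open>y\<close>,
    known modulo \<open>p\<close>.\<close>
  define v where "v n = shiftn 1 (w n)" for n
  have v: "v n \<in> X" for n unfolding v_def using w by (rule system_shiftn)
  have pv: "\<pi> (\<Phi> n (v n)) = shiftn ((k ^ n - d n) mod p) y" for n
  proof -
    have "\<Phi> n (v n) = shiftn (k ^ n) (\<Phi> n (w n))"
      unfolding v_def subst_pow_shiftn[OF k_pos] by simp
    also have "\<dots> = shiftn (k ^ n - d n) (shiftn (d n) (\<Phi> n (w n)))"
      unfolding shiftn_shiftn using d[of n] by simp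
    also have "shiftn (d n) (\<Phi> n (w n)) = x" by (rule xw[symmetric])
    finally have "\<pi> (\<Phi> n (v n)) = \<pi> (shiftn (k ^ n - d n) x)" by (rule arg_cong)
    also have "\<dots> = shiftn (k ^ n - d n) y" unfolding y_def by (rule code_shiftn[OF x])
    finally show ?thesis using y_mod by metis
  qed
  define f where "f a = \<phi> a ! 0" for a
  have first: "\<Phi> n u 0 = (f ^^ n) (u 0)" for n u
    unfolding f_def by (rule subst_pow_first)
  \<comment> \<open>The first-letter map acts on a finite alphabet, so its iterates repeat, with
    preperiod \<open>j\<close> and period \<open>Q\<close>.\<close>
  have "\<not> inj (\<lambda>i. f ^^ i)"
    using finite_imageD[of "\<lambda>i. f ^^ i" "UNIV :: nat set"] by (meson finite infinite_UNIV_nat)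
  then obtain j j' where jj: "j < j'" "f ^^ j = f ^^ j'"
    unfolding inj_on_def by (metis nat_neq_iff)
  define Q where "Q = j' - j"
  have Q: "Q \<ge> 1" and fQ: "f ^^ (Q + j) = f ^^ j" using jj by (auto simp: Q_def)
  define g where "g n = (v n 0, (n - j) mod Q, (k ^ n - d n) mod p)" for n
  have "g ` {j..} \<subseteq> UNIV \<times> {..<Q} \<times> {..<p}" using Q p(1) by (auto simp: g_def)
  moreover have "finite ((UNIV :: 'a set) \<times> {..<Q} \<times> {..<p})" by simp
  ultimately have "finite (g ` {j..})" by (rule finite_subset)
  then obtain c where inf: "infinite {n\<in>{j..}. g n = c}"
    using infinite_fibre[OF _ infinite_Ici] by blast
  obtain a t s where c: "c = (a, t, s)" using prod_cases3 by blast
  define I where "I = {n\<in>{j..}. g n = c}"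
  have I: "j \<le> n" "v n 0 = a" "(n - j) mod Q = t" "(k ^ n - d n) mod p = s" if "n \<in> I" for n
    using that by (auto simp: I_def g_def c)
  have I_large: "\<exists>n\<in>I. n \<ge> m" for m
    using inf unfolding I_def infinite_nat_iff_unbounded_le by blast
  then obtain n0 where n0: "n0 \<in> I" by blast
  have sp: "s < p" using I(4)[OF n0] p(1) by auto
  define b where "b = (f ^^ j) a"
  have fb: "(f ^^ (Q * i)) b = b" for i
  proof (induction i)
    case (Suc i)
    have "(f ^^ Q) b = b" using fQ by (simp add: b_def funpow_add fun_eq_iff)
    then show ?case using Suc by (simp add: funpow_add)
  qed (simp add: b_def)
  \<comment> \<open>Only the first \<open>k ^ M\<close> letters matter. Since \<open>f ^^ Q\<close>
    fixes \<open>b\<close>, these prefixes are compatible along each residue class of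
    \<open>M\<close> modulo \<open>Q\<close>.\<close>
  define u where "u M = \<Phi> M (\<lambda>_. b)" for M
  have u_le: "u M' i = u M i" if "M \<le> M'" "M mod Q = M' mod Q" "i < k ^ M" for M M' i
  proof -
    have "Q dvd M' - M" using that(1,2) by (metis mod_eq_dvd_iff_nat)
    then obtain q where q: "M' - M = Q * q" by blast
    then have "M' = M + Q * q" using that(1) by linarith
    then have "u M' = \<Phi> M (\<Phi> (Q * q) (\<lambda>_. b))" by (simp add: u_def funpow_add)
    moreover have "\<Phi> M (\<Phi> (Q * q) (\<lambda>_. b)) i = \<Phi> M (\<lambda>_. b) i"
    proof (rule subst_pow_prefix[OF k_pos, of 1])
      show "\<Phi> (Q * q) (\<lambda>_. b) r' = b" if "r' < 1" for r'
        using that first[of "Q * q" "\<lambda>_. b"] fb by simp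
    qed (use that(3) in simp)
    ultimately show ?thesis by (simp add: u_def)
  qed
  have u_eq: "u M' i = u M i" if "M mod Q = M' mod Q" "i < k ^ M" "i < k ^ M'" for M M' i
  proof (cases "M \<le> M'")
    case True
    then show ?thesis using that by (intro u_le)
  next
    case False
    then have "M' \<le> M" by simp
    then show ?thesis using u_le[OF _ that(1)[symmetric] that(3)] by simp
  qed
  \<comment> \<open>The limit of \<open>u M\<close> along the class of \<open>n0 - j\<close>. The
    level read at coordinate \<open>i\<close> is at least \<open>i\<close>, so its reliable prefix
    is longer than \<open>i\<close>.\<close>
  define xs where "xs i = u (n0 - j + Q * i) i" for i
  have xs: "xs i = u M i" if "M mod Q = (n0 - j) mod Q" "i < k ^ M" for M i
    unfolding xs_def
  proof (rule u_eq)
    have "i \<le> n0 - j + Q * i" using Q by (simp add: trans_le_add2)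
    then show "i < k ^ (n0 - j + Q * i)" using less_power_k[of "n0 - j + Q * i"] by linarith
  qed (use that in simp_all)
  \<comment> \<open>For \<open>n\<close> in \<open>I\<close>, the sequence
    \<open>\<Phi> j (v n)\<close> starts with \<open>b\<close>, so the remaining
    \<open>n - j\<close> steps reproduce the prefix of \<open>u (n - j)\<close>.\<close>
  have xs_I: "xs i = \<Phi> n (v n) i" if n: "n \<in> I" and i: "i < n - j" for n i
  proof -
    have "(n - j) mod Q = (n0 - j) mod Q" using I(3)[OF n] I(3)[OF n0] by simp
    moreover have ik: "i < k ^ (n - j)" using i less_power_k[of "n - j"] by linarith
    ultimately have "xs i = u (n - j) i" by (rule xs)
    moreover have "\<Phi> n (v n) = \<Phi> (n - j) (\<Phi> j (v n))"
      using funpow_add[of "n - j" j "subst_seq k \<phi>"] I(1)[OF n] by simp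
    moreover have "\<Phi> (n - j) (\<Phi> j (v n)) i = \<Phi> (n - j) (\<lambda>_. b) i"
    proof (rule subst_pow_prefix[OF k_pos, of 1])
      show "\<Phi> j (v n) r' = b" if "r' < 1" for r'
        using that first[of j "v n"] I(2)[OF n] by (simp add: b_def)
    qed (use ik in simp)
    ultimately show ?thesis by (simp add: u_def)
  qed
  have xsX: "xs \<in> X"
  proof (rule system_closed)
    fix m
    obtain n where "n \<in> I" "n \<ge> m + j" using I_large by blast
    then have "agree m xs (\<Phi> n (v n))" using xs_I by (auto simp: agree_def)
    then show "\<exists>x'\<in>X. agree m xs x'" using system_subst_pow[OF v] by blast
  qed
  have pxs: "\<pi> xs = shiftn s y"
  proof
    fix i
    obtain n where n: "n \<in> I" "n \<ge> i + r + j" using I_large by blast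
    have "\<pi> xs i = \<pi> (\<Phi> n (v n)) i"
      using n xs_I by (intro block_code xsX system_subst_pow v) auto
    then show "\<pi> xs i = shiftn s y i" using pv[of n] I(4)[OF n(1)] by metis
  qed
  have fix_xs: "\<Phi> Q xs = xs"
  proof
    fix i
    define M where "M = n0 - j + Q * i"
    have "i \<le> M" using Q by (simp add: M_def trans_le_add2)
    then have iM: "i < k ^ M" using less_power_k[of M] by linarith
    have "\<Phi> Q xs i = \<Phi> Q (u M) i"
    proof (rule subst_pow_prefix[OF k_pos, of "k ^ M"])
      show "xs r' = u M r'" if "r' < k ^ M" for r'
        using that by (intro xs) (simp_all add: M_def)
      have "k ^ M * 1 \<le> k ^ M * k ^ Q" using k_pos by (intro mult_le_mono) auto
      then show "i < k ^ M * k ^ Q" using iM by linarith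
    qed
    also have "\<Phi> Q (u M) = u (Q + M)" by (simp add: u_def funpow_add)
    also have "u (Q + M) i = xs i"
    proof (rule xs[symmetric])
      have "k ^ M \<le> k ^ (Q + M)" using k_pos by (intro power_increasing) auto
      then show "i < k ^ (Q + M)" using iM by linarith
    qed (simp add: M_def)
    finally show "\<Phi> Q xs i = xs i" .
  qed
  \<comment> \<open>The image of \<open>xs\<close> is \<open>y\<close> shifted by \<open>s\<close>;
    a further shift by \<open>p - s\<close> completes the period and gives \<open>y\<close>
    itself.\<close>
  have "quasi_fixed k \<phi> (shiftn (p - s) xs)"
  proof (rule quasi_fixedI[OF refl _ Q])
    show "\<Phi> Q (shiftn (p - s) xs) = shiftn (k ^ Q * (p - s)) xs"
      unfolding subst_pow_shiftn[OF k_pos] fix_xs ..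
  qed
  moreover have "\<pi> (shiftn (p - s) xs) = y"
    unfolding code_shiftn[OF xsX] pxs shiftn_shiftn using sp p(2) by simp
  moreover have "shiftn (p - s) xs \<in> X" using xsX by (rule system_shiftn)
  ultimately show ?thesis unfolding y_def by blast
qed

end

theorem theorem4p2:
  fixes k :: nat
    and \<phi> :: "'a::finite \<Rightarrow> 'a list"
    and Y :: "(nat \<Rightarrow> 'b::finite) set"
    and \<pi> :: "(nat \<Rightarrow> 'a) \<Rightarrow> (nat \<Rightarrow> 'b)"
  assumes "k \<ge> 2"
    and "const_length k \<phi>"
    and "subshift Y"
    and "factor_map (subst_system \<phi>) Y \<pi>"
  shows "(\<forall>y\<in>Y. automatic k y \<longleftrightarrow> (\<exists>x\<in>subst_system \<phi>. quasi_fixed k \<phi> x \<and> \<pi> x = y))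
    \<and> (\<forall>y\<in>Y. automatic k y \<and> \<not> periodic_seq y \<longrightarrow>
          (\<forall>x\<in>subst_system \<phi>. \<pi> x = y \<longrightarrow> quasi_fixed k \<phi> x))"
proof -
  interpret const_length_subst k \<phi> using assms(1,2) by unfold_locales
  obtain r where r: "\<And>x x' i i'. x \<in> X \<Longrightarrow> x' \<in> X \<Longrightarrow> (\<And>j. j < r \<Longrightarrow> x (i + j) = x' (i' + j)) \<Longrightarrow>
    \<pi> x i = \<pi> x' i'"
    using factor_map_block_code[OF assms(4)] by blast
  interpret subst_block_code k \<phi> \<pi> r by unfold_locales (rule r; blast)
  \<comment> \<open>Over a nonperiodic \<open>y\<close> any preimage will do; over a periodic one
    the preimage may have to be exchanged for another.\<close>
  have "\<exists>x\<in>X. quasi_fixed k \<phi> x \<and> \<pi> x = y" if y: "y \<in> Y" "automatic k y" for y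
  proof -
    obtain x where x: "x \<in> X" "\<pi> x = y" using assms(4) y(1) by (auto simp: factor_map_def)
    then show ?thesis
      using quasi_fixed_over_periodic[of x] quasi_fixed_if_automatic_nonperiodic[of x] y(2) by blast
  qed
  then show ?thesis
    using automatic_if_quasi_fixed quasi_fixed_if_automatic_nonperiodic by blast
qed

end
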